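(* Consider an instance of the optimal transmission switching problem (OTS) whose fixed lines contain a connected spanning subgraph of the network (that is, the undirected graph with vertex set $\mathcal{B}$ and edge set $\mathcal{L}\setminus\mathcal{S}$ is connected). Then for every flexible line $(i,j)\in\mathcal{S}$, the inequality $$M_{ij}^{\mathrm{opt}}\le B_{ij}\times p_{\mathcal{I};ij}$$ holds. Moreover, there exists an instance of the OTS whose fixed lines contain a connected spanning subgraph of the network, with a flexible line $(i,j)$, for which this inequality is tight, i.e. $M_{ij}^{\mathrm{opt}}=B_{ij}\times p_{\mathcal{I};ij}$.
   Context: **Instance of the OTS.** An instance consists of: a finite set of buses $\mathcal{B}=\{1,\dots,n_b\}$; a finite set of lines $\mathcal{L}$, each line being an ordered pair $(i,j)$ of distinct buses (each line is given one arbitrary direction, and at most one line joins any two buses); a subset $\mathcal{S}\subseteq\mathcal{L}$ of flexible (switchable) lines, the lines in $\mathcal{L}\setminus\mathcal{S}$ being called fixed; a finite set of generators $\mathcal{G}=\{1,\dots,n_g\}$, each located at one bus, with $\mathcal{N}_g(i)\subseteq\mathcal{G}$ the (possibly empty) set of generators at bus $i$; production bounds $p_k^{\min}\le p_k^{\max}$ for $k\in\mathcal{G}$; demands $d_i$ for $i\in\mathcal{B}$; a capacity $f_{ij}^{\max}>0$ and a susceptance $B_{ij}>0$ for every $(i,j)\in\mathcal{L}$; an integer $r$; and cost functions $g_k(p)=a_kp^2+b_kp+c_k$ with $a_k,b_k,c_k\ge 0$ for $k\in\mathcal{G}$ (the case $a_k=0$ is the linear cost). Write $\mathcal{N}_l^+(i)=\{j\in\mathcal{B}:(i,j)\in\mathcal{L}\}$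 and $\mathcal{N}_l^-(i)=\{j\in\mathcal{B}:(j,i)\in\mathcal{L}\}$. **The OTS problem and its feasible region.** The variables are $\mathbf{f}=(f_{ij})_{(i,j)\in\mathcal{L}}$ (flows), $\mathbf{x}=(x_{ij})_{(i,j)\in\mathcal{S}}$ (switch statuses), $\Theta=(\theta_i)_{i\in\mathcal{B}}$ (voltage angles) and $\mathbf{p}=(p_k)_{k\in\mathcal{G}}$ (productions). The OTS is to minimize $\sum_{k\in\mathcal{G}}g_k(p_k)$ subject to - $x_{ij}\in\{0,1\}$ for all $(i,j)\in\mathcal{S}$; - $p_k^{\min}\le p_k\le p_k^{\max}$ for all $k\in\mathcal{G}$; - $-f_{ij}^{\max}x_{ij}\le f_{ij}\le f_{ij}^{\max}x_{ij}$ for all $(i,j)\in\mathcal{S}$; - $-f_{ij}^{\max}\le f_{ij}\le f_{ij}^{\max}$ for all $(i,j)\in\mathcal{L}\setminus\mathcal{S}$; - (switch constraint) $B_{ij}(\theta_i-\theta_j)x_{ij}=f_{ij}$ for all $(i,j)\in\mathcal{S}$; - $B_{ij}(\theta_i-\theta_j)=f_{ij}$ for all $(i,j)\in\mathcal{L}\setminus\mathcal{S}$; - $\sum_{k\in\mathcal{N}_g(i)}p_k-d_i=\sum_{j\in\mathcal{N}_l^+(i)}f_{ij}-\sum_{j\in\mathcal{N}_l^-(i)}f_{ji}$ for all $i\in\mathcal{B}$; - $\sum_{(i,j)\in\mathcal{S}}x_{ij}\ge r$. Let $\mathcal{F}$ be the set of all real $\{\mathbf{f},\mathbf{x},\Theta,\mathbf{p}\}$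 satisfying these constraints. **Big-$M$ parameters.** For $(i,j)\in\mathcal{S}$ and a scalar $M_{ij}$, the big-$M$ constraint is $$B_{ij}(\theta_i-\theta_j)-M_{ij}(1-x_{ij})\le f_{ij}\le B_{ij}(\theta_i-\theta_j)+M_{ij}(1-x_{ij}).$$ The number $M_{ij}$ is called feasible for the OTS if replacing the switch constraint of the line $(i,j)$ by this big-$M$ constraint leaves the feasible region $\mathcal{F}$ unchanged. $M_{ij}^{\mathrm{opt}}$ denotes the smallest feasible $M_{ij}$ (with value $+\infty$ if no finite $M_{ij}$ is feasible and $-\infty$ if every real number is feasible). **Shortest path length.** $G_{\mathcal{I}}$ is the undirected weighted graph with vertex set $\mathcal{B}$ and edge set $\mathcal{L}\setminus\mathcal{S}$ (directions forgotten), where the edge $(r,l)$ has weight $w_{rl}=f_{rl}^{\max}/B_{rl}$. $p_{\mathcal{I};ij}$ denotes the length (total weight) of a shortest simple path between $i$ and $j$ in $G_{\mathcal{I}}$. *)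

theory Defs
  imports
    "HOL-Library.FuncSet"
    "HOL-Library.Extended_Real"
    "Graph_Theory.Digraph_Component"
    "Graph_Theory.Weighted_Graph"
begin

section \<open>Instances of optimal transmission switching (OTS)\<close>

text \<open>
  Costs are \<open>cost_a k * p\<^sup>2 + cost_b k * p + cost_c k\<close>. The data are total functions; only
  their values on the buses, lines and generators of the instance matter.
\<close>

type_synonym bus = nat
type_synonym line = "bus \<times> bus"
type_synonym generator = nat

record ots =
  num_buses :: nat
  lines :: "line set"
  flexible :: "line set"
  num_gens :: nat
  gen_bus :: "generator \<Rightarrow> bus"
  p_min :: "generator \<Rightarrow> real"
  p_max :: "generator \<Rightarrow> real"
  demand :: "bus \<Rightarrow> real"
  f_max :: "line \<Rightarrow> real"
  suscept :: "line \<Rightarrow> real"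
  min_switched_on :: int
  cost_a :: "generator \<Rightarrow> real"
  cost_b :: "generator \<Rightarrow> real"
  cost_c :: "generator \<Rightarrow> real"

definition buses :: "ots \<Rightarrow> bus set" where
  "buses I = {1..num_buses I}"

definition gens :: "ots \<Rightarrow> generator set" where
  "gens I = {1..num_gens I}"

definition fixed_lines :: "ots \<Rightarrow> line set" where
  "fixed_lines I = lines I - flexible I"

definition gens_at :: "ots \<Rightarrow> bus \<Rightarrow> generator set" where
  "gens_at I i = {k \<in> gens I. gen_bus I k = i}"

definition out_nbrs :: "ots \<Rightarrow> bus \<Rightarrow> bus set" where
  "out_nbrs I i = {j \<in> buses I. (i, j) \<in> lines I}"

definition in_nbrs :: "ots \<Rightarrow> bus \<Rightarrow> bus set" where
  "in_nbrs I i = {j \<in> buses I. (j, i) \<in> lines I}"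

definition ots_instance :: "ots \<Rightarrow> bool" where
  "ots_instance I \<longleftrightarrow>
     lines I \<subseteq> buses I \<times> buses I \<and>
     (\<forall>(i, j) \<in> lines I. i \<noteq> j \<and> (j, i) \<notin> lines I) \<and>
     flexible I \<subseteq> lines I \<and>
     (\<forall>k \<in> gens I. gen_bus I k \<in> buses I) \<and>
     (\<forall>k \<in> gens I. p_min I k \<le> p_max I k) \<and>
     (\<forall>l \<in> lines I. f_max I l > 0 \<and> suscept I l > 0) \<and>
     (\<forall>k \<in> gens I. cost_a I k \<ge> 0 \<and> cost_b I k \<ge> 0 \<and> cost_c I k \<ge> 0)"

section \<open>The feasible region\<close>

record ots_point =
  flow :: "line \<Rightarrow> real"
  status :: "line \<Rightarrow> real"
  angle :: "bus \<Rightarrow> real"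
  production :: "generator \<Rightarrow> real"

definition total_cost :: "ots \<Rightarrow> ots_point \<Rightarrow> real" where
  "total_cost I z =
     (\<Sum>k \<in> gens I. cost_a I k * (production z k)^2 + cost_b I k * production z k + cost_c I k)"

text \<open>
  The families of variables are indexed by the lines, flexible lines, buses and generators, hence
  the \<^const>\<open>extensional\<close> conditions.
\<close>

definition basic_constraints :: "ots \<Rightarrow> ots_point \<Rightarrow> bool" where
  "basic_constraints I z \<longleftrightarrow>
     flow z \<in> extensional (lines I) \<and>
     status z \<in> extensional (flexible I) \<and>
     angle z \<in> extensional (buses I) \<and>
     production z \<in> extensional (gens I) \<and>
     (\<forall>l \<in> flexible I. status z l \<in> {0, 1}) \<and>
     (\<forall>k \<in> gens I. p_min I k \<le> production z k \<and> production z k \<le> p_max I k) \<and>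
     (\<forall>l \<in> flexible I. - f_max I l * status z l \<le> flow z l \<and> flow z l \<le> f_max I l * status z l) \<and>
     (\<forall>l \<in> fixed_lines I. - f_max I l \<le> flow z l \<and> flow z l \<le> f_max I l) \<and>
     (\<forall>(i, j) \<in> fixed_lines I. suscept I (i, j) * (angle z i - angle z j) = flow z (i, j)) \<and>
     (\<forall>i \<in> buses I.
        (\<Sum>k \<in> gens_at I i. production z k) - demand I i =
        (\<Sum>j \<in> out_nbrs I i. flow z (i, j)) - (\<Sum>j \<in> in_nbrs I i. flow z (j, i))) \<and>
     (\<Sum>l \<in> flexible I. status z l) \<ge> of_int (min_switched_on I)"

fun switch_constraint :: "ots \<Rightarrow> ots_point \<Rightarrow> line \<Rightarrow> bool" where
  "switch_constraint I z (i, j) \<longleftrightarrow>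
     suscept I (i, j) * (angle z i - angle z j) * status z (i, j) = flow z (i, j)"

fun bigM_constraint :: "ots \<Rightarrow> ots_point \<Rightarrow> line \<Rightarrow> real \<Rightarrow> bool" where
  "bigM_constraint I z (i, j) M \<longleftrightarrow>
     suscept I (i, j) * (angle z i - angle z j) - M * (1 - status z (i, j)) \<le> flow z (i, j) \<and>
     flow z (i, j) \<le> suscept I (i, j) * (angle z i - angle z j) + M * (1 - status z (i, j))"

definition feasible_region :: "ots \<Rightarrow> ots_point set" where
  "feasible_region I =
     {z. basic_constraints I z \<and> (\<forall>l \<in> flexible I. switch_constraint I z l)}"

section \<open>Big-M parameters\<close>

definition bigM_region :: "ots \<Rightarrow> line \<Rightarrow> real \<Rightarrow> ots_point set" where
  "bigM_region I l M =
     {z. basic_constraints I z \<and> (\<forall>l' \<in> flexible I - {l}. switch_constraint I z l') \<and>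
         bigM_constraint I z l M}"

definition bigM_feasible :: "ots \<Rightarrow> line \<Rightarrow> real \<Rightarrow> bool" where
  "bigM_feasible I l M \<longleftrightarrow> bigM_region I l M = feasible_region I"

definition M_opt :: "ots \<Rightarrow> line \<Rightarrow> ereal" where
  "M_opt I l =
     (if \<forall>M. \<not> bigM_feasible I l M then \<infinity>
      else if \<forall>M. bigM_feasible I l M then - \<infinity>
      else ereal (LEAST M. bigM_feasible I l M))"

section \<open>The graph of fixed lines and shortest paths\<close>

definition fixed_digraph :: "ots \<Rightarrow> (bus, line) pre_digraph" where
  "fixed_digraph I = with_proj \<lparr>pverts = buses I, parcs = fixed_lines I\<rparr>"

text \<open>
  The undirected graph of fixed lines is the symmetric closure of this digraph, which is also what
  the library's notion of a connected digraph refers to. The qualified name is needed because of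
  topological connectedness.
\<close>

definition fixed_graph :: "ots \<Rightarrow> (bus, line) pre_digraph" where
  "fixed_graph I = with_proj (mk_symmetric (fixed_digraph I))"

definition fixed_lines_connected :: "ots \<Rightarrow> bool" where
  "fixed_lines_connected I \<longleftrightarrow> Digraph_Component.connected (fixed_digraph I)"

text \<open>An arc traversed against the direction of its line carries the weight of that line.\<close>

fun edge_weight :: "ots \<Rightarrow> bus \<times> bus \<Rightarrow> real" where
  "edge_weight I (u, v) =
     (if (u, v) \<in> lines I then f_max I (u, v) / suscept I (u, v)
      else f_max I (v, u) / suscept I (v, u))"

text \<open>
  \<open>Min\<close> is meaningful only if the two buses are joined by a path of fixed lines.
\<close>

definition shortest_path_length :: "ots \<Rightarrow> bus \<Rightarrow> bus \<Rightarrow> real" where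
  "shortest_path_length I i j =
     Min (wf_digraph.awalk_cost (edge_weight I) ` {p. pre_digraph.apath (fixed_graph I) i p j})"

end

theory Submission
  imports Defs
begin

text \<open>
  With the line switched on, the big-M constraint coincides with the switch constraint whatever M
  is; with the line switched off, it bounds the scaled angle difference across the line by M. So
  the feasible M are the upper bounds of the angle differences occurring at feasible points with
  the line off. Such a difference telescopes along a path of fixed lines, where each line
  \<open>(u, v)\<close> contributes at most \<open>f_max (u, v) / suscept (u, v)\<close>. Tightness: in a triangle of unit
  data with two fixed lines in series, transporting one unit with the third line off saturates
  both fixed lines.
\<close>

lemma ots_instanceD:
  assumes "ots_instance I"
  shows "lines I \<subseteq> buses I \<times> buses I"
    and "(u, v) \<in> lines I \<Longrightarrow> (v, u) \<notin> lines I"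
    and "flexible I \<subseteq> lines I"
    and "l \<in> lines I \<Longrightarrow> suscept I l > 0"
  using assms unfolding ots_instance_def by auto

section \<open>Feasible big-M values as upper bounds\<close>

text \<open>The absolute value merges the two sides of the big-M constraint. The set may be empty,
  namely when no feasible point has the line switched off.\<close>

definition off_differences :: "ots \<Rightarrow> line \<Rightarrow> real set" where
  "off_differences I l =
     (\<lambda>z. \<bar>suscept I l * (angle z (fst l) - angle z (snd l))\<bar>) `
       {z \<in> feasible_region I. status z l = 0}"

text \<open>The capacity bounds force zero flow on a switched-off line, so its switch constraint
  holds for all angles. Hence the big-M region lies in the feasible region for every
  \<open>M\<close>, and only the converse inclusion restricts \<open>M\<close>.\<close>

lemma bigM_feasible_iff:
  assumes l: "l \<in> flexible I"
  shows "bigM_feasible I l M \<longleftrightarrow> (\<forall>v \<in> off_differences I l. v \<le> M)"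
proof -
  obtain i j where ij: "l = (i, j)" by (cases l)
  have status: "status z l = 0 \<or> status z l = 1"
    and off: "status z l = 0 \<Longrightarrow> flow z l = 0" if "basic_constraints I z" for z
    using that l unfolding basic_constraints_def by force+
  have iff: "z \<in> bigM_region I l M \<longleftrightarrow>
      z \<in> feasible_region I \<and>
      (status z l = 0 \<longrightarrow> \<bar>suscept I l * (angle z (fst l) - angle z (snd l))\<bar> \<le> M)" for z
  proof (cases "basic_constraints I z")
    case basic: True
    have "bigM_constraint I z l M \<longleftrightarrow> switch_constraint I z l \<and>
      (status z l = 0 \<longrightarrow> \<bar>suscept I l * (angle z (fst l) - angle z (snd l))\<bar> \<le> M)"
      using status[OF basic] off[OF basic] by (auto simp: ij)
    with basic l show ?thesis
      unfolding bigM_region_def feasible_region_def by auto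
  qed (simp add: bigM_region_def feasible_region_def)
  show ?thesis
    unfolding bigM_feasible_def set_eq_iff iff off_differences_def by auto
qed

text \<open>If the line is never off, every \<open>M\<close> is feasible and \<open>M_opt\<close> is
  minus infinity. Otherwise the least upper bound exists by completeness of the reals, and it is at
  most the upper bound \<open>c\<close>.\<close>

lemma M_opt_le:
  assumes l: "l \<in> flexible I" and c: "\<And>v. v \<in> off_differences I l \<Longrightarrow> v \<le> c"
  shows "M_opt I l \<le> ereal c"
proof (cases "off_differences I l = {}")
  case True
  then show ?thesis
    unfolding M_opt_def bigM_feasible_iff[OF l] by simp
next
  case False
  then obtain v where v: "v \<in> off_differences I l" by auto
  have bdd: "bdd_above (off_differences I l)"
    using c by (auto simp: bdd_above_def)
  have "(LEAST M. bigM_feasible I l M) = Sup (off_differences I l)"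
    unfolding bigM_feasible_iff[OF l]
    using False bdd by (intro Least_equality) (auto intro: cSup_upper cSup_least)
  \<comment> \<open>The values \<open>v - 1\<close> and \<open>c\<close> exclude the two infinite
    cases of \<open>M_opt\<close>.\<close>
  moreover have "\<not> bigM_feasible I l (v - 1)" "bigM_feasible I l c"
    unfolding bigM_feasible_iff[OF l] using v c by force+
  moreover have "Sup (off_differences I l) \<le> c"
    using False c by (intro cSup_least)
  ultimately show ?thesis
    unfolding M_opt_def by auto
qed

text \<open>The element \<open>v\<close> excludes the value minus infinity. What remains is the
  supremum of the differences, or plus infinity if they are unbounded.\<close>

lemma M_opt_ge:
  assumes l: "l \<in> flexible I" and v: "v \<in> off_differences I l"
  shows "ereal v \<le> M_opt I l"
proof (cases "bdd_above (off_differences I l)")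
  case True
  have "(LEAST M. bigM_feasible I l M) = Sup (off_differences I l)"
    unfolding bigM_feasible_iff[OF l]
    using v True by (intro Least_equality) (auto intro: cSup_upper cSup_least)
  moreover have "\<not> bigM_feasible I l (v - 1)"
    unfolding bigM_feasible_iff[OF l] using v by force
  ultimately show ?thesis
    unfolding M_opt_def using cSup_upper[OF v True] by auto
next
  case False
  then have "\<forall>M. \<not> bigM_feasible I l M"
    unfolding bigM_feasible_iff[OF l] by (auto simp: bdd_above_def)
  then show ?thesis
    by (simp add: M_opt_def)
qed

section \<open>The graph of fixed lines\<close>

lemma arcs_fixed_graph:
  "(u, v) \<in> arcs (fixed_graph I) \<longleftrightarrow> (u, v) \<in> fixed_lines I \<or> (v, u) \<in> fixed_lines I"
  unfolding fixed_graph_def fixed_digraph_def by (auto simp: parcs_mk_symmetric Bex_def)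

lemma verts_fixed_graph [simp]: "verts (fixed_graph I) = buses I"
  and tail_fixed_graph [simp]: "tail (fixed_graph I) = fst"
  and head_fixed_graph [simp]: "head (fixed_graph I) = snd"
  by (simp_all add: fixed_graph_def fixed_digraph_def)

text \<open>Finiteness leaves only finitely many simple paths between two buses, which makes the
  \<open>Min\<close> in \<open>shortest_path_length\<close> meaningful.\<close>

lemma fin_digraph_fixed_graph:
  assumes "ots_instance I"
  shows "fin_digraph (fixed_graph I)"
proof -
  have sub: "arcs (fixed_graph I) \<subseteq> buses I \<times> buses I"
    using ots_instanceD(1)[OF assms] arcs_fixed_graph[of _ _ I]
    unfolding fixed_lines_def by auto
  moreover have "finite (buses I)"
    by (simp add: buses_def)
  ultimately have "finite (arcs (fixed_graph I))"
    by (meson finite_SigmaI finite_subset)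
  with sub \<open>finite (buses I)\<close> show ?thesis
    by unfold_locales auto
qed

section \<open>Angle differences along paths\<close>

lemma angle_difference_le_edge_weight:
  assumes I: "ots_instance I" and z: "basic_constraints I z"
    and uv: "(u, v) \<in> arcs (fixed_graph I)"
  shows "\<bar>angle z u - angle z v\<bar> \<le> edge_weight I (u, v)"
proof -
  have fixed: "\<bar>angle z a - angle z b\<bar> \<le> f_max I (a, b) / suscept I (a, b)"
    if ab: "(a, b) \<in> fixed_lines I" for a b
  proof -
    have pos: "suscept I (a, b) > 0"
      using ots_instanceD(4)[OF I] ab by (auto simp: fixed_lines_def)
    have "\<bar>suscept I (a, b) * (angle z a - angle z b)\<bar> \<le> f_max I (a, b)"
      using z ab unfolding basic_constraints_def by fastforce
    with pos show ?thesis
      by (simp add: abs_mult pos_le_divide_eq mult.commute)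
  qed
  show ?thesis
  proof (cases "(u, v) \<in> fixed_lines I")
    case True
    with fixed[OF True] show ?thesis by (auto simp: fixed_lines_def)
  next
    case False
    with uv have vu: "(v, u) \<in> fixed_lines I" by (simp add: arcs_fixed_graph)
    \<comment> \<open>Two buses share at most one line, so no flexible line \<open>(u, v)\<close>
      can supply the weight: \<open>edge_weight\<close> takes it from \<open>(v, u)\<close>.\<close>
    then have "(u, v) \<notin> lines I"
      using ots_instanceD(2)[OF I] by (auto simp: fixed_lines_def)
    with fixed[OF vu] show ?thesis by (simp add: abs_minus_commute)
  qed
qed

text \<open>Triangle inequality, cutting off the first arc. Working with walks keeps the induction
  free of distinctness conditions.\<close>

lemma angle_difference_le_awalk_cost:
  assumes I: "ots_instance I" and z: "basic_constraints I z"
    and p: "pre_digraph.awalk (fixed_graph I) u p v"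
  shows "\<bar>angle z u - angle z v\<bar> \<le> wf_digraph.awalk_cost (edge_weight I) p"
proof -
  interpret G: fin_digraph "fixed_graph I" by (rule fin_digraph_fixed_graph[OF I])
  show ?thesis
    using p
  proof (induction p arbitrary: u)
    case Nil
    then show ?case by (simp add: G.awalk_Nil_iff)
  next
    case (Cons e p)
    obtain w where e: "e = (u, w)" "(u, w) \<in> arcs (fixed_graph I)" "G.awalk w p v"
      using Cons.prems by (cases e) (auto simp: G.awalk_Cons_iff)
    have "\<bar>angle z u - angle z v\<bar> \<le> \<bar>angle z u - angle z w\<bar> + \<bar>angle z w - angle z v\<bar>"
      by simp
    also have "\<dots> \<le> edge_weight I (u, w) + G.awalk_cost (edge_weight I) p"
      by (intro add_mono angle_difference_le_edge_weight[OF I z e(2)] Cons.IH e(3))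
    finally show ?case by (simp add: e(1))
  qed
qed

text \<open>Connectedness provides a simple path, so the minimum is attained by some path, and the
  bound for walks applies to that path.\<close>

lemma angle_difference_le_shortest_path_length:
  assumes I: "ots_instance I" and con: "fixed_lines_connected I"
    and z: "basic_constraints I z" and ij: "i \<in> buses I" "j \<in> buses I"
  shows "\<bar>angle z i - angle z j\<bar> \<le> shortest_path_length I i j"
proof -
  interpret G: fin_digraph "fixed_graph I" by (rule fin_digraph_fixed_graph[OF I])
  have "i \<rightarrow>\<^sup>*\<^bsub>fixed_graph I\<^esub> j"
    using con ij unfolding fixed_lines_connected_def connected_def strongly_connected_def
      fixed_graph_def by (simp add: fixed_digraph_def)
  then have "{p. G.apath i p j} \<noteq> {}"
    by (auto simp: G.reachable_apath)
  then have "shortest_path_length I i j \<in> G.awalk_cost (edge_weight I) ` {p. G.apath i p j}"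
    unfolding shortest_path_length_def by (intro Min_in finite_imageI G.apaths_finite) auto
  then show ?thesis
    using angle_difference_le_awalk_cost[OF I z] by (auto simp: G.apath_def)
qed

lemma M_opt_le_shortest_path_length:
  assumes I: "ots_instance I" and con: "fixed_lines_connected I" and ij: "(i, j) \<in> flexible I"
  shows "M_opt I (i, j) \<le> ereal (suscept I (i, j) * shortest_path_length I i j)"
proof (rule M_opt_le[OF ij])
  fix v assume "v \<in> off_differences I (i, j)"
  then obtain z where z: "basic_constraints I z"
      and v: "v = \<bar>suscept I (i, j) * (angle z i - angle z j)\<bar>"
    by (auto simp: off_differences_def feasible_region_def)
  have line: "(i, j) \<in> lines I" using ots_instanceD(3)[OF I] ij by auto
  then have "i \<in> buses I" "j \<in> buses I" using ots_instanceD(1)[OF I] by auto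
  from angle_difference_le_shortest_path_length[OF I con z this]
  show "v \<le> suscept I (i, j) * shortest_path_length I i j"
    using ots_instanceD(4)[OF I line] by (simp add: v abs_mult)
qed

section \<open>An instance attaining the bound\<close>

text \<open>The value 0 of \<open>min_switched_on\<close> allows the only flexible line to be off.
  The demand of bus 3 must then travel from the generator at bus 1 through bus 2.\<close>

definition triangle :: ots where
  "triangle = \<lparr>num_buses = 3, lines = {(1, 2), (2, 3), (1, 3)}, flexible = {(1, 3)},
     num_gens = 1, gen_bus = (\<lambda>_. 1), p_min = (\<lambda>_. 0), p_max = (\<lambda>_. 1),
     demand = (\<lambda>i. if i = 3 then 1 else 0), f_max = (\<lambda>_. 1), suscept = (\<lambda>_. 1),
     min_switched_on = 0, cost_a = (\<lambda>_. 0), cost_b = (\<lambda>_. 1), cost_c = (\<lambda>_. 0)\<rparr>"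

text \<open>The angles 2, 1, 0 drop by one along each fixed line, so each carries exactly its
  capacity.\<close>

definition triangle_point :: ots_point where
  "triangle_point =
    \<lparr>flow = restrict (\<lambda>l. if l = (1, 3) then 0 else 1) (lines triangle),
     status = restrict (\<lambda>_. 0) (flexible triangle),
     angle = restrict (\<lambda>i. 3 - real i) (buses triangle),
     production = restrict (\<lambda>_. 1) (gens triangle)\<rparr>"

lemma buses_triangle: "buses triangle = {1, 2, 3}"
  by (auto simp: buses_def triangle_def)

lemma gens_triangle: "gens triangle = {1}"
  by (auto simp: gens_def triangle_def)

lemma fixed_lines_triangle: "fixed_lines triangle = {(1, 2), (2, 3)}"
  by (auto simp: fixed_lines_def triangle_def)

lemma ots_instance_triangle: "ots_instance triangle"
  unfolding ots_instance_def buses_triangle gens_triangle by (simp add: triangle_def)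

lemma fixed_lines_connected_triangle: "fixed_lines_connected triangle"
proof -
  interpret G: fin_digraph "fixed_graph triangle"
    by (rule fin_digraph_fixed_graph[OF ots_instance_triangle])
  have step: "u \<rightarrow>\<^sup>*\<^bsub>fixed_graph triangle\<^esub> v"
    if "(u, v) \<in> {(1, 2), (2, 3), (2, 1), (3, 2)}" for u v
  proof -
    have "(u, v) \<in> arcs (fixed_graph triangle)"
      using that by (auto simp: arcs_fixed_graph fixed_lines_triangle)
    then have "G.awalk u [(u, v)] v"
      using G.arc_implies_awalk[of "(u, v)"] by simp
    then show ?thesis by (rule G.reachable_awalkI)
  qed
  \<comment> \<open>Bus 2 is adjacent to both other buses, so any two buses are linked through
    it.\<close>
  have "2 \<rightarrow>\<^sup>*\<^bsub>fixed_graph triangle\<^esub> 2"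
    by (rule G.reachable_refl) (simp add: buses_triangle)
  then have "u \<rightarrow>\<^sup>*\<^bsub>fixed_graph triangle\<^esub> 2 \<and> 2 \<rightarrow>\<^sup>*\<^bsub>fixed_graph triangle\<^esub> u" if "u \<in> {1, 2, 3}" for u
    using that step[of 1 2] step[of 2 1] step[of 3 2] step[of 2 3] by (elim insertE) simp_all
  then have "u \<rightarrow>\<^sup>*\<^bsub>fixed_graph triangle\<^esub> v" if "u \<in> {1, 2, 3}" "v \<in> {1, 2, 3}" for u v
    using that G.reachable_trans[of u 2 v] by simp
  then show ?thesis
    unfolding fixed_lines_connected_def connected_def strongly_connected_def
      fixed_graph_def by (simp add: fixed_digraph_def buses_triangle)
qed

lemma triangle_point_feasible: "triangle_point \<in> feasible_region triangle"
proof -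
  have nbrs: "gens_at triangle 1 = {1}" "gens_at triangle 2 = {}" "gens_at triangle 3 = {}"
    "out_nbrs triangle 1 = {2, 3}" "out_nbrs triangle 2 = {3}" "out_nbrs triangle 3 = {}"
    "in_nbrs triangle 1 = {}" "in_nbrs triangle 2 = {1}" "in_nbrs triangle 3 = {1, 2}"
    unfolding gens_at_def out_nbrs_def in_nbrs_def buses_triangle gens_triangle
    by (auto simp: triangle_def)
  have "basic_constraints triangle triangle_point"
    unfolding basic_constraints_def buses_triangle gens_triangle fixed_lines_triangle
    by (simp add: nbrs nbrs[unfolded One_nat_def])
       (simp add: triangle_point_def buses_triangle gens_triangle, simp add: triangle_def)
  then show ?thesis
    by (simp add: feasible_region_def triangle_point_def buses_triangle)
       (simp add: triangle_def)
qed

lemma shortest_path_length_triangle_le: "shortest_path_length triangle 1 3 \<le> 2"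
proof -
  interpret G: fin_digraph "fixed_graph triangle"
    by (rule fin_digraph_fixed_graph[OF ots_instance_triangle])
  have "G.apath 1 [(1, 2), (2, 3)] 3"
    by (auto simp: G.apath_simps arcs_fixed_graph fixed_lines_triangle buses_triangle)
  then have "shortest_path_length triangle 1 3 \<le> G.awalk_cost (edge_weight triangle) [(1, 2), (2, 3)]"
    unfolding shortest_path_length_def
    by (intro Min_le finite_imageI G.apaths_finite imageI CollectI)
  then show ?thesis by (simp add: triangle_def)
qed

text \<open>The general bound gives one inequality. For the other, the feasible point shows that
  \<open>M_opt\<close> is at least 2, while the path through bus 2 shows that the right-hand side is
  at most 2; no exact path length has to be computed.\<close>

lemma M_opt_triangle:
  "M_opt triangle (1, 3) = ereal (suscept triangle (1, 3) * shortest_path_length triangle 1 3)"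
proof (rule antisym)
  have flex: "(1, 3) \<in> flexible triangle" by (simp add: triangle_def)
  show "M_opt triangle (1, 3) \<le> ereal (suscept triangle (1, 3) * shortest_path_length triangle 1 3)"
    by (rule M_opt_le_shortest_path_length[OF ots_instance_triangle fixed_lines_connected_triangle flex])
  have "2 \<in> off_differences triangle (1, 3)"
    unfolding off_differences_def
  proof (rule image_eqI)
    show "triangle_point \<in> {z \<in> feasible_region triangle. status z (1, 3) = 0}"
      using triangle_point_feasible flex by (simp add: triangle_point_def)
    show "2 = \<bar>suscept triangle (1, 3) *
        (angle triangle_point (fst (1 :: bus, 3 :: bus)) - angle triangle_point (snd (1 :: bus, 3 :: bus)))\<bar>"
      by (simp add: triangle_point_def buses_triangle) (simp add: triangle_def)
  qed
  then have "ereal 2 \<le> M_opt triangle (1, 3)"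
    by (rule M_opt_ge[OF flex])
  moreover have "suscept triangle (1, 3) * shortest_path_length triangle 1 3 \<le> 2"
    using shortest_path_length_triangle_le by (simp add: triangle_def)
  ultimately show "ereal (suscept triangle (1, 3) * shortest_path_length triangle 1 3)
      \<le> M_opt triangle (1, 3)"
    by (meson ereal_less_eq(3) order_trans)
qed

theorem theorem3:
  shows "(\<forall>I. ots_instance I \<and> fixed_lines_connected I \<longrightarrow>
            (\<forall>(i, j) \<in> flexible I.
               M_opt I (i, j) \<le> ereal (suscept I (i, j) * shortest_path_length I i j))) \<and>
         (\<exists>I i j. ots_instance I \<and> fixed_lines_connected I \<and> (i, j) \<in> flexible I \<and>
            M_opt I (i, j) = ereal (suscept I (i, j) * shortest_path_length I i j))"
proof
  have "(1, 3) \<in> flexible triangle" by (simp add: triangle_def)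
  with ots_instance_triangle fixed_lines_connected_triangle M_opt_triangle
  show "\<exists>I i j. ots_instance I \<and> fixed_lines_connected I \<and> (i, j) \<in> flexible I \<and>
      M_opt I (i, j) = ereal (suscept I (i, j) * shortest_path_length I i j)"
    by blast
qed (auto intro!: M_opt_le_shortest_path_length)

end
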